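(* Let $n\ge 2$. (1) An element $f\in A^+(B_n)$ is of $k$-support with $k\neq n$ (i.e. $|\mathrm{supp}(f)|\ne n$) if and only if $f$ is a regular element of the additive semigroup $(A^+(B_n),+)$. (2) The set of idempotents of $(A^+(B_n),+)$ is $$\{\xi_\alpha : \alpha\in I(B_n)\}\cup\{{}^{(i,j)}\zeta_{(k,k)} : i,j,k\in[n]\}.$$
   Context: For $n\ge 1$ let $[n]=\{1,\dots,n\}$. The Brandt semigroup $(B_n,+)$ has underlying set $B_n=([n]\times[n])\cup\{\vartheta\}$ with $(i,j)+(k,l)=(i,l)$ if $j=k$, $(i,j)+(k,l)=\vartheta$ if $j\ne k$, and $\alpha+\vartheta=\vartheta+\alpha=\vartheta$ for all $\alpha\in B_n$. Its set of idempotents is $I(B_n)=\{(k,k):k\in[n]\}\cup\{\vartheta\}$. $M(B_n)$ is the set of all maps $B_n\to B_n$; arguments are written on the left of functions. It carries pointwise addition $\alpha(f+g)=\alpha f+\alpha g$ and composition $\alpha(f\circ g)=(\alpha f)g$. An affine map over $B_n$ is a map of the form $g+h$ with $g$ an endomorphism of the semigroup $(B_n,+)$ (not required to fix $\vartheta$) and $h\in M(B_n)$ a constant map. $A^+(B_n)$ (the affine near-semiring over $B_n$) is the smallest subset of $M(B_n)$ that contains all affine maps and is closed under $+$ and $\circ$. The support of $f\in M(B_n)$ is $\mathrm{supp}(f)=\{\alpha\in B_n : \alpha f\neq\vartheta\}$; $f$ is of $k$-support if $|\mathrm{supp}(f)|=k$. For $\alpha\in B_n$, $\xi_\alpha$ is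 the constant map on $B_n$ with value $\alpha$. For $k,l,p,q\in[n]$, ${}^{(k,l)}\zeta_{(p,q)}$ is the map sending $(k,l)$ to $(p,q)$ and every other element of $B_n$ to $\vartheta$. An element $f$ of $(A^+(B_n),+)$ is regular if $f+g+f=f$ for some $g\in A^+(B_n)$. *)

theory Defs
  imports "HOL-Library.FuncSet"
begin

section \<open>The Brandt semigroup\<close>

text \<open>
  The addition does not depend on \<open>n\<close>, so it is defined once on pairs of arbitrary natural
  numbers; \<open>B\<^sub>n\<close> is the subsemigroup with indices in \<open>{1..n}\<close>.
\<close>

datatype brandt = Theta (\<open>\<theta>\<close>) | Elt nat nat

instantiation brandt :: semigroup_add
begin

fun plus_brandt :: "brandt \<Rightarrow> brandt \<Rightarrow> brandt" where
  "Elt i j + Elt k l = (if j = k then Elt i l else \<theta>)"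
| "\<theta> + b = \<theta>"
| "a + \<theta> = \<theta>"

instance
proof
  fix a b c :: brandt
  show "a + b + c = a + (b + c)"
    by (cases a; cases b; cases c) auto
qed

end

definition Brandt :: "nat \<Rightarrow> brandt set" where
  "Brandt n = insert \<theta> {Elt i j | i j. i \<in> {1..n} \<and> j \<in> {1..n}}"

definition Idem :: "nat \<Rightarrow> brandt set" where
  "Idem n = insert \<theta> {Elt k k | k. k \<in> {1..n}}"

lemma brandt_add_closed: "a \<in> Brandt n \<Longrightarrow> b \<in> Brandt n \<Longrightarrow> a + b \<in> Brandt n"
  by (cases a; cases b) (auto simp: Brandt_def)

lemma Idem_eq: "Idem n = {a \<in> Brandt n. a + a = a}"
  by (auto simp: Brandt_def Idem_def split: if_splits)


section \<open>Maps on the Brandt semigroup\<close>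

text \<open>
  Maps \<open>B\<^sub>n \<rightarrow> B\<^sub>n\<close> are represented extensionally (value \<^const>\<open>undefined\<close> outside \<open>B\<^sub>n\<close>), so that
  equality of representatives is equality of maps.
\<close>

definition Maps :: "nat \<Rightarrow> (brandt \<Rightarrow> brandt) set" where
  "Maps n = Brandt n \<rightarrow>\<^sub>E Brandt n"

definition madd :: "nat \<Rightarrow> (brandt \<Rightarrow> brandt) \<Rightarrow> (brandt \<Rightarrow> brandt) \<Rightarrow> brandt \<Rightarrow> brandt" where
  "madd n f g = (\<lambda>a\<in>Brandt n. f a + g a)"

text \<open>Arguments are written on the left of maps, so in \<open>f \<circ> g\<close> the map \<open>f\<close> is applied first.\<close>

definition mcomp :: "nat \<Rightarrow> (brandt \<Rightarrow> brandt) \<Rightarrow> (brandt \<Rightarrow> brandt) \<Rightarrow> brandt \<Rightarrow> brandt" where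
  "mcomp n f g = (\<lambda>a\<in>Brandt n. g (f a))"

definition const_map :: "nat \<Rightarrow> brandt \<Rightarrow> brandt \<Rightarrow> brandt" (\<open>\<xi>\<close>) where
  "\<xi> n a = (\<lambda>x\<in>Brandt n. a)"

definition single_map :: "nat \<Rightarrow> nat \<times> nat \<Rightarrow> nat \<times> nat \<Rightarrow> brandt \<Rightarrow> brandt" (\<open>\<zeta>\<close>) where
  "\<zeta> n kl pq = (\<lambda>x\<in>Brandt n. if x = Elt (fst kl) (snd kl) then Elt (fst pq) (snd pq) else \<theta>)"

definition endos :: "nat \<Rightarrow> (brandt \<Rightarrow> brandt) set" where
  "endos n = {g \<in> Maps n. \<forall>a\<in>Brandt n. \<forall>b\<in>Brandt n. g (a + b) = g a + g b}"

definition affine_maps :: "nat \<Rightarrow> (brandt \<Rightarrow> brandt) set" where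
  "affine_maps n = {madd n g (\<xi> n a) | g a. g \<in> endos n \<and> a \<in> Brandt n}"

inductive_set affine_near_semiring :: "nat \<Rightarrow> (brandt \<Rightarrow> brandt) set" (\<open>A\<^sup>+\<close>) for n :: nat where
  affine: "f \<in> affine_maps n \<Longrightarrow> f \<in> A\<^sup>+ n"
| add: "f \<in> A\<^sup>+ n \<Longrightarrow> g \<in> A\<^sup>+ n \<Longrightarrow> madd n f g \<in> A\<^sup>+ n"
| comp: "f \<in> A\<^sup>+ n \<Longrightarrow> g \<in> A\<^sup>+ n \<Longrightarrow> mcomp n f g \<in> A\<^sup>+ n"

lemma affine_near_semiring_subset_maps: "A\<^sup>+ n \<subseteq> Maps n"
proof
  fix f assume "f \<in> A\<^sup>+ n"
  then show "f \<in> Maps n"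
  proof induction
    case (affine f)
    then obtain g a where f: "f = madd n g (\<xi> n a)" and g: "g \<in> Maps n" and a: "a \<in> Brandt n"
      by (auto simp: affine_maps_def endos_def)
    show ?case
      using g a unfolding f Maps_def madd_def const_map_def
      by (auto intro!: brandt_add_closed)
  next
    case (add f g)
    then show ?case
      unfolding Maps_def madd_def by (auto intro!: brandt_add_closed)
  next
    case (comp f g)
    then show ?case
      unfolding Maps_def mcomp_def by auto
  qed
qed

definition supp :: "nat \<Rightarrow> (brandt \<Rightarrow> brandt) \<Rightarrow> brandt set" where
  "supp n f = {a \<in> Brandt n. f a \<noteq> \<theta>}"

definition of_support :: "nat \<Rightarrow> nat \<Rightarrow> (brandt \<Rightarrow> brandt) \<Rightarrow> bool" where
  "of_support n k f \<longleftrightarrow> card (supp n f) = k"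

lemma finite_supp: "finite (supp n f)"
proof -
  have "Brandt n = insert \<theta> ((\<lambda>(i, j). Elt i j) ` ({1..n} \<times> {1..n}))"
    by (auto simp: Brandt_def)
  then have "finite (Brandt n)"
    by simp
  then show ?thesis
    by (simp add: supp_def)
qed

definition add_regular :: "nat \<Rightarrow> (brandt \<Rightarrow> brandt) \<Rightarrow> bool" where
  "add_regular n f \<longleftrightarrow> f \<in> A\<^sup>+ n \<and> (\<exists>g\<in>A\<^sup>+ n. madd n (madd n f g) f = f)"

definition add_idempotents :: "nat \<Rightarrow> (brandt \<Rightarrow> brandt) set" where
  "add_idempotents n = {f \<in> A\<^sup>+ n. madd n f f = f}"

end

theory Submission
  imports Defs
begin

text \<open>
  For \<open>n \<ge> 2\<close> an endomorphism of the Brandt semigroup is constant or is induced by a permutation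
  of the indices. Adding a constant to the latter confines the support to one column \<open>{(i, k) | i}\<close>,
  on which the map is \<open>(i, k) \<mapsto> (\<sigma> i, q)\<close>. Constants, singleton-support maps and these column maps
  are closed under both operations, so they exhaust the affine near-semiring. The first two kinds
  are visibly regular. A column map is not: an additive inverse would have to
  send \<open>(i, k)\<close> to \<open>(q, \<sigma> i)\<close> for every \<open>i\<close>, but on a column of size at least two no affine map
  has non-\<open>\<theta>\<close> values with a varying second index.
\<close>

section \<open>Normal forms for the maps and their evaluation\<close>

definition column_map :: "nat \<Rightarrow> nat \<Rightarrow> nat \<Rightarrow> (nat \<Rightarrow> nat) \<Rightarrow> brandt \<Rightarrow> brandt" where
  "column_map n k q \<sigma> =
     (\<lambda>x\<in>Brandt n. case x of \<theta> \<Rightarrow> \<theta> | Elt i j \<Rightarrow> if j = k then Elt (\<sigma> i) q else \<theta>)"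

text \<open>An upper bound for \<open>A\<^sup>+ n\<close>. There is no recursion here; the inductive
  format supplies the case split into the three kinds.\<close>

inductive_set affine_forms :: "nat \<Rightarrow> (brandt \<Rightarrow> brandt) set" for n :: nat where
  const: "a \<in> Brandt n \<Longrightarrow> \<xi> n a \<in> affine_forms n"
| single: "i \<in> {1..n} \<Longrightarrow> j \<in> {1..n} \<Longrightarrow> p \<in> {1..n} \<Longrightarrow> q \<in> {1..n} \<Longrightarrow>
    \<zeta> n (i, j) (p, q) \<in> affine_forms n"
| column: "k \<in> {1..n} \<Longrightarrow> q \<in> {1..n} \<Longrightarrow> bij_betw \<sigma> {1..n} {1..n} \<Longrightarrow>
    column_map n k q \<sigma> \<in> affine_forms n"

lemma Theta_in_Brandt [simp]: "\<theta> \<in> Brandt n"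
  by (simp add: Brandt_def)

lemma Elt_in_Brandt_iff [simp]: "Elt i j \<in> Brandt n \<longleftrightarrow> i \<in> {1..n} \<and> j \<in> {1..n}"
  by (auto simp: Brandt_def)

lemma add_Theta_right [simp]: "a + \<theta> = (\<theta> :: brandt)"
  by (cases a) auto

lemma zero_in_affine_forms [simp]: "\<xi> n \<theta> \<in> affine_forms n"
  by (rule affine_forms.const) simp

lemma map_eqI:
  assumes "f \<in> extensional (Brandt n)" "g \<in> extensional (Brandt n)"
    and "f \<theta> = g \<theta>"
    and "\<And>i j. i \<in> {1..n} \<Longrightarrow> j \<in> {1..n} \<Longrightarrow> f (Elt i j) = g (Elt i j)"
  shows "f = g"
proof (rule extensionalityI[OF assms(1,2)])
  fix x assume "x \<in> Brandt n"
  then show "f x = g x"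
    using assms(3,4) by (cases x) auto
qed

lemma map_extensional [simp]:
  "madd n f g \<in> extensional (Brandt n)"
  "mcomp n f g \<in> extensional (Brandt n)"
  "\<xi> n a \<in> extensional (Brandt n)"
  "\<zeta> n kl pq \<in> extensional (Brandt n)"
  "column_map n k q \<sigma> \<in> extensional (Brandt n)"
  by (auto simp: madd_def mcomp_def const_map_def single_map_def column_map_def)

lemma madd_apply [simp]: "a \<in> Brandt n \<Longrightarrow> madd n f g a = f a + g a"
  by (simp add: madd_def)

lemma mcomp_apply [simp]: "a \<in> Brandt n \<Longrightarrow> mcomp n f g a = g (f a)"
  by (simp add: mcomp_def)

lemma const_map_apply [simp]: "x \<in> Brandt n \<Longrightarrow> \<xi> n a x = a"
  by (simp add: const_map_def)

lemma single_map_apply [simp]: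
  "x \<in> Brandt n \<Longrightarrow> \<zeta> n (i, j) (p, q) x = (if x = Elt i j then Elt p q else \<theta>)"
  by (simp add: single_map_def)

lemma column_map_Theta [simp]: "column_map n k q \<sigma> \<theta> = \<theta>"
  by (simp add: column_map_def)

lemma column_map_Elt [simp]:
  "i \<in> {1..n} \<Longrightarrow> j \<in> {1..n} \<Longrightarrow>
    column_map n k q \<sigma> (Elt i j) = (if j = k then Elt (\<sigma> i) q else \<theta>)"
  by (simp add: column_map_def)

lemma affine_forms_subset_Maps: "affine_forms n \<subseteq> Maps n"
proof
  fix f assume "f \<in> affine_forms n"
  then show "f \<in> Maps n"
  proof cases
    case (column k q \<sigma>)
    have "f x \<in> Brandt n" if "x \<in> Brandt n" for x
      using that column bij_betw_apply[OF column(4)] by (cases x) auto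
    then show ?thesis
      by (simp add: column(1) Maps_def PiE_def)
  qed (auto simp: Maps_def const_map_def single_map_def)
qed

lemma Maps_apply: "f \<in> Maps n \<Longrightarrow> x \<in> Brandt n \<Longrightarrow> f x \<in> Brandt n"
  unfolding Maps_def by (rule PiE_mem)

lemma affine_forms_apply: "f \<in> affine_forms n \<Longrightarrow> x \<in> Brandt n \<Longrightarrow> f x \<in> Brandt n"
  using Maps_apply affine_forms_subset_Maps by blast


section \<open>Endomorphisms\<close>

text \<open>The image of \<theta> is idempotent, and \<open>x + \<theta> = \<theta>\<close> forces
  every other image to agree with it unless it is \<theta>. When \<theta> is fixed, one further
  element sent to \<theta> drags all others along; otherwise the idempotents \<open>Elt i i\<close>
  go to idempotents \<open>Elt s s\<close>, and these determine a permutation.\<close>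

lemma endo_cases:
  assumes g: "g \<in> endos n"
  obtains (const) a where "a \<in> Brandt n" "g = \<xi> n a"
  | (perm) \<sigma> where "bij_betw \<sigma> {1..n} {1..n}" "g \<theta> = \<theta>"
      "\<And>i j. i \<in> {1..n} \<Longrightarrow> j \<in> {1..n} \<Longrightarrow> g (Elt i j) = Elt (\<sigma> i) (\<sigma> j)"
proof -
  have hom: "g (a + b) = g a + g b" if "a \<in> Brandt n" "b \<in> Brandt n" for a b
    using g that by (auto simp: endos_def)
  have maps: "g a \<in> Brandt n" if "a \<in> Brandt n" for a
    using g that by (auto simp: endos_def Maps_def)
  have ext: "g \<in> extensional (Brandt n)"
    using g by (simp add: endos_def Maps_def PiE_def)
  consider (A) a b where "g \<theta> = Elt a b"
    | (B) i j where "g \<theta> = \<theta>" "i \<in> {1..n}" "j \<in> {1..n}" "g (Elt i j) = \<theta>"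
    | (C) "g \<theta> = \<theta>" "\<forall>i\<in>{1..n}. \<forall>j\<in>{1..n}. g (Elt i j) \<noteq> \<theta>"
    by (cases "g \<theta>") blast+
  then show thesis
  proof cases
    case A
    have "g x = Elt a b" if "x \<in> Brandt n" for x
    proof -
      have "g x + Elt a b = Elt a b" "Elt a b + Elt a b = Elt a b"
        using hom[of x \<theta>] hom[of \<theta> \<theta>] that A by simp_all
      then show ?thesis
        by (cases "g x") (auto split: if_splits)
    qed
    then have "g = \<xi> n (Elt a b)"
      by (intro extensionalityI[OF ext]) auto
    then show thesis
      using maps[of \<theta>] A by (intro const[of "Elt a b"]) auto
  next
    case B
    \<comment> \<open>Every \<open>Elt k l\<close> factors through the killed element:
      \<open>Elt k i + (Elt i j + Elt j l)\<close>.\<close>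
    have "g (Elt k l) = \<theta>" if "k \<in> {1..n}" "l \<in> {1..n}" for k l
      using hom[of "Elt k i" "Elt i l"] hom[of "Elt i j" "Elt j l"] that B by simp
    then have "g = \<xi> n \<theta>"
      using B by (intro map_eqI[OF ext]) auto
    then show thesis
      by (intro const[of \<theta>]) auto
  next
    case C
    have "\<exists>s. g (Elt i i) = Elt s s" if "i \<in> {1..n}" for i
      using hom[of "Elt i i" "Elt i i"] that C(2)
      by (cases "g (Elt i i)") (auto split: if_splits)
    then obtain \<sigma> where \<sigma>: "g (Elt i i) = Elt (\<sigma> i) (\<sigma> i)" if "i \<in> {1..n}" for i
      by metis
    have eq: "g (Elt i j) = Elt (\<sigma> i) (\<sigma> j)" if ij: "i \<in> {1..n}" "j \<in> {1..n}" for i j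
    proof -
      \<comment> \<open>The left unit \<open>Elt i i\<close> and the right unit
        \<open>Elt j j\<close> of \<open>Elt i j\<close> fix the two indices of its image.\<close>
      have "Elt (\<sigma> i) (\<sigma> i) + g (Elt i j) = g (Elt i j)"
        "g (Elt i j) + Elt (\<sigma> j) (\<sigma> j) = g (Elt i j)"
        using hom[of "Elt i i" "Elt i j"] hom[of "Elt i j" "Elt j j"] ij \<sigma>
        by (metis Elt_in_Brandt_iff plus_brandt.simps(1))+
      moreover obtain a b where ab: "g (Elt i j) = Elt a b"
        using ij C(2) by (meson brandt.exhaust)
      ultimately show ?thesis
        unfolding ab by (simp split: if_splits)
    qed
    \<comment> \<open>For distinct \<open>i\<close> and \<open>j\<close> the idempotents
      \<open>Elt i i\<close> and \<open>Elt j j\<close> sum to \<theta>, whereas equal images would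
      have a sum other than \<theta>.\<close>
    have "inj_on \<sigma> {1..n}"
    proof (rule inj_onI, rule ccontr)
      fix i j assume ij: "i \<in> {1..n}" "j \<in> {1..n}" "\<sigma> i = \<sigma> j" "i \<noteq> j"
      then show False
        using hom[of "Elt i i" "Elt j j"] \<sigma> C(1) by simp
    qed
    moreover have "\<sigma> ` {1..n} \<subseteq> {1..n}"
    proof safe
      fix i assume "i \<in> {1..n}"
      then show "\<sigma> i \<in> {1..n}"
        using maps[of "Elt i i"] \<sigma> by simp
    qed
    ultimately have "bij_betw \<sigma> {1..n} {1..n}"
      by (simp add: bij_betw_def endo_inj_surj)
    then show thesis
      using perm C(1) eq by blast
  qed
qed


section \<open>The elements of the affine near-semiring\<close>

lemma madd_const_const: "madd n (\<xi> n a) (\<xi> n b) = \<xi> n (a + b)"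
  by (rule extensionalityI[where A = "Brandt n"]) auto

lemma affine_maps_subset_forms: "affine_maps n \<subseteq> affine_forms n"
proof
  fix f assume "f \<in> affine_maps n"
  then obtain g a where f: "f = madd n g (\<xi> n a)" and g: "g \<in> endos n" and a: "a \<in> Brandt n"
    by (auto simp: affine_maps_def)
  from g show "f \<in> affine_forms n"
  proof (cases rule: endo_cases)
    case (const b)
    then show ?thesis
      using a by (simp add: f madd_const_const affine_forms.const brandt_add_closed)
  next
    case (perm \<sigma>)
    show ?thesis
    proof (cases a)
      case Theta
      have "f = \<xi> n \<theta>"
        unfolding f Theta by (rule map_eqI[where n = n]) auto
      then show ?thesis by simp
    next
      case (Elt p q)
      then have pq: "p \<in> {1..n}" "q \<in> {1..n}"
        using a by auto
      \<comment> \<open>Adding \<open>Elt p q\<close> on the right keeps only the elements whose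
        second index is mapped to \<open>p\<close>, that is, the column of the preimage of
        \<open>p\<close>.\<close>
      then obtain k where k: "k \<in> {1..n}" "p = \<sigma> k"
        using perm(1) by (metis bij_betw_imp_surj_on imageE)
      have inj: "\<sigma> j = \<sigma> k \<longleftrightarrow> j = k" if "j \<in> {1..n}" for j
        using perm(1) k that by (meson bij_betw_imp_inj_on inj_on_eq_iff)
      have "f = column_map n k q \<sigma>"
        unfolding f Elt using pq perm k inj by (intro map_eqI[where n = n]) auto
      then show ?thesis
        using k pq perm by (simp add: affine_forms.column)
    qed
  qed
qed

text \<open>The value at \<open>Elt i j\<close> may itself be \<theta>, so closure proofs only have
  to locate the support, not compute the value.\<close>

lemma affine_forms_singleI:
  assumes "f \<in> Maps n" "i \<in> {1..n}" "j \<in> {1..n}"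
    and "\<And>x. x \<in> Brandt n \<Longrightarrow> x \<noteq> Elt i j \<Longrightarrow> f x = \<theta>"
  shows "f \<in> affine_forms n"
proof -
  have ext: "f \<in> extensional (Brandt n)"
    using assms(1) by (simp add: Maps_def PiE_def)
  have "f (Elt i j) \<in> Brandt n"
    using assms(1-3) by (simp add: Maps_apply)
  show ?thesis
  proof (cases "f (Elt i j)")
    case Theta
    have "f = \<xi> n \<theta>"
    proof (rule extensionalityI[OF ext])
      fix x assume "x \<in> Brandt n"
      then show "f x = \<xi> n \<theta> x"
        using Theta assms(4)[of x] by (cases "x = Elt i j") simp_all
    qed simp
    then show ?thesis by simp
  next
    case (Elt p q)
    have "f = \<zeta> n (i, j) (p, q)"
    proof (rule extensionalityI[OF ext])
      fix x assume "x \<in> Brandt n"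
      then show "f x = \<zeta> n (i, j) (p, q) x"
        using Elt assms(4)[of x] by (cases "x = Elt i j") simp_all
    qed simp
    then show ?thesis
      using assms(2,3) Elt \<open>f (Elt i j) \<in> Brandt n\<close> by (simp add: affine_forms.single)
  qed
qed

section \<open>Closure of the normal forms under addition and composition\<close>

lemma madd_Maps: "f \<in> Maps n \<Longrightarrow> g \<in> Maps n \<Longrightarrow> madd n f g \<in> Maps n"
  by (auto simp: Maps_def madd_def intro!: brandt_add_closed)

lemma mcomp_Maps: "f \<in> Maps n \<Longrightarrow> g \<in> Maps n \<Longrightarrow> mcomp n f g \<in> Maps n"
  by (auto simp: Maps_def mcomp_def)

text \<open>The non-\<theta> values of any form share one second index \<open>r\<close>, while the
  first indices along the column of the right summand are pairwise distinct. Hence the sum can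
  survive at one point only.\<close>

lemma affine_forms_add_column:
  assumes f: "f \<in> affine_forms n" and k: "k \<in> {1..n}" "q \<in> {1..n}"
    and \<sigma>: "bij_betw \<sigma> {1..n} {1..n}"
  shows "madd n f (column_map n k q \<sigma>) \<in> affine_forms n"
proof -
  let ?g = "column_map n k q \<sigma>"
  have M: "madd n f ?g \<in> Maps n"
    using f affine_forms.column[OF k \<sigma>] affine_forms_subset_Maps by (intro madd_Maps) auto
  have inj: "\<sigma> i = \<sigma> j \<longleftrightarrow> i = j" if "i \<in> {1..n}" "j \<in> {1..n}" for i j
    using \<sigma> that by (meson bij_betw_imp_inj_on inj_on_eq_iff)
  have row: ?thesis if r: "r \<in> {1..n}"
    and vals: "\<And>x. x \<in> Brandt n \<Longrightarrow> f x = \<theta> \<or> (\<exists>p. f x = Elt p r)" for r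
  proof -
    obtain i where i: "i \<in> {1..n}" "\<sigma> i = r"
      using \<sigma> r by (metis bij_betw_imp_surj_on imageE)
    show ?thesis
    proof (rule affine_forms_singleI[OF M i(1) k(1)])
      fix x assume x: "x \<in> Brandt n" "x \<noteq> Elt i k"
      show "madd n f ?g x = \<theta>"
      proof (cases x)
        case (Elt a b)
        then have "a \<in> {1..n}" "b \<in> {1..n}"
          using x by auto
        then show ?thesis
          using x Elt vals[of x] inj[of a i] i by auto
      qed simp
    qed
  qed
  from f show ?thesis
  proof cases
    case (const a)
    show ?thesis
    proof (cases a)
      case Theta
      then show ?thesis
        \<comment> \<open>The zero map meets the condition for every index; \<open>k\<close> is
          simply one known to be in range.\<close>
        using const k by (intro row[of k]) auto
    next
      case (Elt p r)
      then show ?thesis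
        using const by (intro row[of r]) auto
    qed
  next
    case (single i j p r)
    then show ?thesis
      by (intro row[of r]) auto
  next
    case (column l r \<tau>)
    have "f x = \<theta> \<or> (\<exists>p. f x = Elt p r)" if "x \<in> Brandt n" for x
      using that column by (cases x) auto
    then show ?thesis
      using column by (intro row[of r]) auto
  qed
qed

text \<open>A singleton right summand bounds the support of the sum by one point, and a constant
  right summand either changes the common second index of a column map or annihilates the
  map.\<close>

lemma affine_forms_add:
  assumes f: "f \<in> affine_forms n" and g: "g \<in> affine_forms n"
  shows "madd n f g \<in> affine_forms n"
proof -
  have M: "madd n f g \<in> Maps n"
    using f g affine_forms_subset_Maps by (intro madd_Maps) auto
  from g show ?thesis
  proof cases
    case (column k q \<sigma>)
    then show ?thesis
      using affine_forms_add_column[OF f] by simp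
  next
    case (single i j p q)
    then show ?thesis
      by (intro affine_forms_singleI[OF M, of i j]) auto
  next
    case (const b)
    from f show ?thesis
    proof cases
      case (const a)
      then show ?thesis
        using \<open>g = \<xi> n b\<close> \<open>b \<in> Brandt n\<close>
        by (simp add: madd_const_const affine_forms.const brandt_add_closed)
    next
      case (single i j p q)
      then show ?thesis
        by (intro affine_forms_singleI[OF M, of i j]) auto
    next
      case (column k r \<sigma>)
      show ?thesis
      proof (cases "\<exists>q. b = Elt r q")
        case True
        then obtain q where b: "b = Elt r q" by blast
        have "madd n f g = column_map n k q \<sigma>"
          unfolding \<open>g = \<xi> n b\<close> b column(1) by (rule map_eqI[where n = n]) auto
        then show ?thesis
          using column const b by (simp add: affine_forms.column)
      next
        case False
        have "madd n f g = \<xi> n \<theta>"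
          unfolding \<open>g = \<xi> n b\<close> column(1) using False
          by (intro map_eqI[where n = n]; cases b) auto
        then show ?thesis by simp
      qed
    qed
  qed
qed

text \<open>If \<open>g\<close> moves \<theta> it is constant, and so is the composite. Otherwise
  \<open>g\<close> preserves \<theta>, so the support can only shrink; two column maps compose to a
  column map exactly when the target column of the first is the source column of the second, and to
  zero otherwise.\<close>

lemma affine_forms_comp:
  assumes f: "f \<in> affine_forms n" and g: "g \<in> affine_forms n"
  shows "mcomp n f g \<in> affine_forms n"
proof (cases "g \<theta> = \<theta>")
  case False
  with g obtain a where a: "a \<in> Brandt n" "g = \<xi> n a"
    by cases auto
  have "mcomp n f g = \<xi> n a"
    using a affine_forms_apply[OF f] by (intro extensionalityI[where A = "Brandt n"]) auto
  then show ?thesis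
    using a by (simp add: affine_forms.const)
next
  case g\<theta>: True
  have M: "mcomp n f g \<in> Maps n"
    using f g affine_forms_subset_Maps by (intro mcomp_Maps) auto
  from f show ?thesis
  proof cases
    case (const a)
    have "mcomp n f g = \<xi> n (g a)"
      unfolding const(1) by (rule extensionalityI[where A = "Brandt n"]) auto
    then show ?thesis
      using affine_forms_apply[OF g const(2)] by (simp add: affine_forms.const)
  next
    case (single i j p q)
    then show ?thesis
      using g\<theta> by (intro affine_forms_singleI[OF M, of i j]) auto
  next
    case f: (column k q \<sigma>)
    have \<sigma>: "\<sigma> i \<in> {1..n}" if "i \<in> {1..n}" for i
      using f(4) that by (rule bij_betw_apply)
    have inj: "\<sigma> i = \<sigma> j \<longleftrightarrow> i = j" if "i \<in> {1..n}" "j \<in> {1..n}" for i j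
      using f(4) that by (meson bij_betw_imp_inj_on inj_on_eq_iff)
    from g show ?thesis
    proof cases
      case (const a)
      then have "mcomp n f g = \<xi> n \<theta>"
        using g\<theta> affine_forms_apply[OF \<open>f \<in> affine_forms n\<close>] by (intro extensionalityI[where A = "Brandt n"]) auto
      then show ?thesis by simp
    next
      case (single i j p r)
      \<comment> \<open>\<open>Elt a k\<close> is the only point of the column that \<open>f\<close>
        can send to the support \<open>Elt i j\<close> of \<open>g\<close>.\<close>
      obtain a where a: "a \<in> {1..n}" "\<sigma> a = i"
        using f(4) single(2) by (metis bij_betw_imp_surj_on imageE)
      show ?thesis
      proof (rule affine_forms_singleI[OF M a(1) f(2)])
        fix x assume x: "x \<in> Brandt n" "x \<noteq> Elt a k"
        show "mcomp n f g x = \<theta>"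
        proof (cases x)
          case (Elt b c)
          then have "b \<in> {1..n}" "c \<in> {1..n}"
            using x by auto
          then show ?thesis
            using x Elt single(1) f(1,3) \<sigma>[of b] inj[of b a] a g\<theta> by auto
        qed (simp add: f(1) g\<theta>)
      qed
    next
      case (column l r \<tau>)
      show ?thesis
      proof (cases "l = q")
        case True
        have "mcomp n f g = column_map n k r (\<tau> \<circ> \<sigma>)"
          unfolding f(1) column(1) True using \<sigma> f(3) by (intro map_eqI[where n = n]) auto
        then show ?thesis
          using f column by (simp add: affine_forms.column bij_betw_trans)
      next
        case False
        have "mcomp n f g = \<xi> n \<theta>"
          unfolding f(1) column(1) using False \<sigma> f(3) by (intro map_eqI[where n = n]) auto
        then show ?thesis by simp
      qed
    qed
  qed
qed

lemma affine_near_semiring_subset_forms: "A\<^sup>+ n \<subseteq> affine_forms n"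
proof
  fix f assume "f \<in> A\<^sup>+ n"
  then show "f \<in> affine_forms n"
    by induction (use affine_maps_subset_forms in
      \<open>auto intro: affine_forms_add affine_forms_comp\<close>)
qed

section \<open>Constants and singleton-support maps belong to the near-semiring\<close>

lemma affine_mapI: "g \<in> endos n \<Longrightarrow> a \<in> Brandt n \<Longrightarrow> madd n g (\<xi> n a) \<in> A\<^sup>+ n"
  by (rule affine_near_semiring.affine) (auto simp: affine_maps_def)

lemma const_map_in_affine:
  assumes "a \<in> Brandt n"
  shows "\<xi> n a \<in> A\<^sup>+ n"
proof -
  \<comment> \<open>An idempotent left unit of \<open>a\<close>: its constant map is an
    endomorphism, so adding \<open>a\<close> yields an affine map.\<close>
  obtain e where e: "e \<in> Idem n" "e + a = a"
  proof (cases a)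
    case (Elt i j)
    then show thesis
      using that[of "Elt i i"] assms by (auto simp: Idem_def)
  qed (use that[of \<theta>] in \<open>simp add: Idem_def\<close>)
  then have "\<xi> n e \<in> endos n"
    by (auto simp: Idem_eq endos_def Maps_def brandt_add_closed const_map_def)
  then have "madd n (\<xi> n e) (\<xi> n a) \<in> A\<^sup>+ n"
    using assms by (intro affine_mapI)
  then show ?thesis
    by (simp add: madd_const_const e)
qed

lemma single_map_in_affine:
  assumes "i \<in> {1..n}" "j \<in> {1..n}" "p \<in> {1..n}" "q \<in> {1..n}"
  shows "\<zeta> n (i, j) (p, q) \<in> A\<^sup>+ n"
proof -
  have "restrict id (Brandt n) \<in> endos n"
    by (auto simp: endos_def Maps_def brandt_add_closed)
  then have "madd n (restrict id (Brandt n)) (\<xi> n (Elt j q)) \<in> A\<^sup>+ n"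
    using assms by (intro affine_mapI) auto
  \<comment> \<open>Adding \<open>Elt j q\<close> on the right of the identity leaves column
    \<open>j\<close>; adding \<open>Elt p i\<close> on the left then selects row \<open>i\<close>
    and replaces it by \<open>p\<close>.\<close>
  moreover have "\<zeta> n (i, j) (p, q) =
      madd n (\<xi> n (Elt p i)) (madd n (restrict id (Brandt n)) (\<xi> n (Elt j q)))"
    by (rule map_eqI[where n = n]) auto
  ultimately show ?thesis
    using assms by (simp add: affine_near_semiring.add const_map_in_affine)
qed


section \<open>Supports, regular elements and idempotents\<close>

lemma card_Brandt: "card (Brandt n) = n * n + 1"
proof -
  have "Brandt n = insert \<theta> ((\<lambda>(i, j). Elt i j) ` ({1..n} \<times> {1..n}))"
    by (auto simp: Brandt_def)
  moreover have "inj_on (\<lambda>(i, j). Elt i j) ({1..n} \<times> {1..n})"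
    by (auto simp: inj_on_def)
  ultimately show ?thesis
    by (subst \<open>Brandt n = _\<close>, subst card_insert_disjoint) (auto simp: card_image)
qed

lemma supp_const_map: "supp n (\<xi> n a) = (if a = \<theta> then {} else Brandt n)"
  by (auto simp: supp_def)

lemma supp_single_map:
  "i \<in> {1..n} \<Longrightarrow> j \<in> {1..n} \<Longrightarrow> supp n (\<zeta> n (i, j) (p, q)) = {Elt i j}"
  by (auto simp: supp_def split: if_splits)

lemma card_supp_column_map:
  assumes "k \<in> {1..n}"
  shows "card (supp n (column_map n k q \<sigma>)) = n"
proof -
  have "supp n (column_map n k q \<sigma>) = (\<lambda>i. Elt i k) ` {1..n}"
    using assms by (auto simp: supp_def Brandt_def split: if_splits)
  then show ?thesis
    by (simp add: card_image inj_on_def)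
qed

lemma const_map_add_regular:
  assumes "a \<in> Brandt n"
  shows "add_regular n (\<xi> n a)"
proof -
  \<comment> \<open>Swapping the indices gives an inverse in the Brandt semigroup, and \<theta> is
    its own inverse.\<close>
  obtain b where "b \<in> Brandt n" "a + b + a = a"
  proof (cases a)
    case Theta
    then show thesis
      using that[of \<theta>] by simp
  next
    case (Elt i j)
    then show thesis
      using that[of "Elt j i"] assms by simp
  qed
  then show ?thesis
    using assms unfolding add_regular_def
    by (auto simp: madd_const_const const_map_in_affine intro!: bexI[of _ "\<xi> n b"])
qed

lemma single_map_add_regular:
  assumes "i \<in> {1..n}" "j \<in> {1..n}" "p \<in> {1..n}" "q \<in> {1..n}"
  shows "add_regular n (\<zeta> n (i, j) (p, q))"
  unfolding add_regular_def
proof (intro conjI bexI)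
  show "madd n (madd n (\<zeta> n (i, j) (p, q)) (\<zeta> n (i, j) (q, p))) (\<zeta> n (i, j) (p, q)) =
      \<zeta> n (i, j) (p, q)"
    by (rule extensionalityI[where A = "Brandt n"]) auto
qed (use assms in \<open>simp_all add: single_map_in_affine\<close>)

lemma column_map_not_add_regular:
  assumes n: "n \<ge> 2" and k: "k \<in> {1..n}" and \<sigma>: "inj_on \<sigma> {1..n}"
  shows "\<not> add_regular n (column_map n k q \<sigma>)"
proof
  let ?f = "column_map n k q \<sigma>"
  assume "add_regular n ?f"
  then obtain g where g: "g \<in> A\<^sup>+ n" and eq: "madd n (madd n ?f g) ?f = ?f"
    by (auto simp: add_regular_def)
  \<comment> \<open>Between two copies of \<open>Elt (\<sigma> i) q\<close>, only this value avoids
    \<theta>.\<close>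
  have val: "g (Elt i k) = Elt q (\<sigma> i)" if i: "i \<in> {1..n}" for i
  proof -
    have "?f (Elt i k) + g (Elt i k) + ?f (Elt i k) = ?f (Elt i k)"
      using fun_cong[OF eq, of "Elt i k"] k i by simp
    then show ?thesis
      using k i by (cases "g (Elt i k)") (auto split: if_splits)
  qed
  have 12: "1 \<in> {1..n}" "2 \<in> {1..n}"
    using n by auto
  then have ne: "\<sigma> 1 \<noteq> \<sigma> 2"
    using \<sigma> by (auto dest: inj_onD)
  have "g \<in> affine_forms n"
    using g affine_near_semiring_subset_forms by auto
  \<comment> \<open>Rows 1 and 2 give two non-\<theta> values of \<open>g\<close> with different
    second indices. A constant or a column map has only one second index, and a singleton-support
    map cannot be non-\<theta> at both points.\<close>
  then show False
    using val[OF 12(1)] val[OF 12(2)] ne 12 k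
    by cases (auto split: if_splits)
qed

text \<open>An idempotent serves as its own inverse.\<close>

lemma regular_idempotent: "f \<in> add_idempotents n \<Longrightarrow> add_regular n f"
  by (auto simp: add_idempotents_def add_regular_def intro!: bexI[of _ f])

text \<open>Constants have support size 0 or \<open>n * n + 1\<close> (\<theta> included), singleton
  maps 1, column maps \<open>n\<close>. As \<open>n \<ge> 2\<close>, size \<open>n\<close> singles
  out the column maps, the only irregular kind.\<close>

lemma add_regular_iff:
  assumes "n \<ge> 2" and f: "f \<in> A\<^sup>+ n"
  shows "add_regular n f \<longleftrightarrow> card (supp n f) \<noteq> n"
  using subsetD[OF affine_near_semiring_subset_forms f]
proof cases
  case (const a)
  have "n * n + 1 \<noteq> n"
    using le_square[of n] by linarith
  then show ?thesis
    using const assms by (simp add: const_map_add_regular supp_const_map card_Brandt)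
next
  case (single i j p q)
  then show ?thesis
    using assms by (simp add: single_map_add_regular supp_single_map)
next
  case (column k q \<sigma>)
  then show ?thesis
    using column_map_not_add_regular[OF \<open>n \<ge> 2\<close>] card_supp_column_map
    by (auto dest: bij_betw_imp_inj_on)
qed

text \<open>Idempotency is tested pointwise at a single argument for constants and singleton maps;
  column maps are excluded because idempotents are regular.\<close>

lemma add_idempotents_eq:
  assumes "n \<ge> 2"
  shows "add_idempotents n =
    {\<xi> n \<alpha> | \<alpha>. \<alpha> \<in> Idem n} \<union>
    {\<zeta> n (i, j) (k, k) | i j k. i \<in> {1..n} \<and> j \<in> {1..n} \<and> k \<in> {1..n}}"
proof (rule set_eqI, rule iffI)
  fix f assume f: "f \<in> add_idempotents n"
  then have idem: "f x + f x = f x" if "x \<in> Brandt n" for x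
    using that unfolding add_idempotents_def by (metis (mono_tags, lifting) madd_apply mem_Collect_eq)
  have "f \<in> affine_forms n"
    using f affine_near_semiring_subset_forms by (auto simp: add_idempotents_def)
  then show "f \<in> {\<xi> n \<alpha> | \<alpha>. \<alpha> \<in> Idem n} \<union>
      {\<zeta> n (i, j) (k, k) | i j k. i \<in> {1..n} \<and> j \<in> {1..n} \<and> k \<in> {1..n}}"
  proof cases
    case (const a)
    then show ?thesis
      using idem[of \<theta>] by (auto simp: Idem_eq)
  next
    case (single i j p q)
    then show ?thesis
      using idem[of "Elt i j"] by (auto split: if_splits)
  next
    case (column k q \<sigma>)
    then show ?thesis
      using regular_idempotent[OF f] column_map_not_add_regular[OF assms] bij_betw_imp_inj_on
      by metis
  qed
next
  fix f assume "f \<in> {\<xi> n \<alpha> | \<alpha>. \<alpha> \<in> Idem n} \<union>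
      {\<zeta> n (i, j) (k, k) | i j k. i \<in> {1..n} \<and> j \<in> {1..n} \<and> k \<in> {1..n}}"
  then show "f \<in> add_idempotents n"
  proof (elim UnE CollectE exE conjE)
    fix a assume "f = \<xi> n a" "a \<in> Idem n"
    then show ?thesis
      by (simp add: add_idempotents_def Idem_eq madd_const_const const_map_in_affine)
  next
    fix i j k assume *: "f = \<zeta> n (i, j) (k, k)" "i \<in> {1..n}" "j \<in> {1..n}" "k \<in> {1..n}"
    have "madd n f f = f"
      unfolding *(1) by (rule extensionalityI[where A = "Brandt n"]) auto
    then show ?thesis
      using * by (simp add: add_idempotents_def single_map_in_affine)
  qed
qed

theorem theorem3p12:
  fixes n :: nat
  assumes "n \<ge> 2"
  shows "(\<forall>f\<in>A\<^sup>+ n. (\<exists>k. k \<noteq> n \<and> of_support n k f) \<longleftrightarrow> add_regular n f) \<and>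
         add_idempotents n =
           {\<xi> n \<alpha> | \<alpha>. \<alpha> \<in> Idem n} \<union>
           {\<zeta> n (i, j) (k, k) | i j k. i \<in> {1..n} \<and> j \<in> {1..n} \<and> k \<in> {1..n}}"
  using add_regular_iff[OF assms] add_idempotents_eq[OF assms] by (simp add: of_support_def)

end
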